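(* Let $(g,\theta,\mathfrak u)$ be an adapted LCP structure on a Lie algebra $\mathfrak g$. Then $\mathfrak g$ is isomorphic to a semidirect product $\mathfrak h\ltimes_\alpha\mathbb R^q$, where $\mathfrak h:=\mathfrak u^\perp$, $q:=\dim\mathfrak u$ and $\alpha:\mathfrak h\to\mathfrak{gl}(\mathbb R^q)$ is a Lie algebra representation. Moreover, there exist a closed 1-form $0\ne\xi\in\mathfrak h^*$ and an orthogonal Lie algebra representation $\beta:\mathfrak h\to\mathfrak{so}(\mathbb R^q)$ such that $\alpha(x)=\xi(x)\mathrm{Id}+\beta(x)$ for all $x\in\mathfrak h$.
   Context: All Lie algebras are real and finite-dimensional; $\mathbb R^q$ is regarded as an abelian Lie algebra. Let $\mathfrak g$ be a Lie algebra with an inner product $g$. For $x\in\mathfrak g$, $\nabla^g_x\in\mathfrak{so}(\mathfrak g)$ is given by $g(\nabla^g_xy,z)=\frac12\big(g([x,y],z)-g([x,z],y)-g([y,z],x)\big)$. For $\theta\in\mathfrak g^*$ with $g$-dual vector $\theta^\sharp$, set $\nabla^\theta_xy:=\nabla^g_xy+\theta(x)y+\theta(y)x-g(x,y)\theta^\sharp$. A 1-form on a Lie algebra is closed if it vanishes on the derived algebra. A subspace $\mathfrak u\subset\mathfrak g$ is $\nabla^\theta$-flat if $\nabla^\theta_x\mathfrak u\subset\mathfrak u$ for all $x\in\mathfrak g$ and $x\mapsto\nabla^\theta_x|_{\mathfrak u}$ is a Lie algebra representation $\mathfrak g\to\mathfrak{gl}(\mathfrak u)$. An LCP structure on $\mathfrak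 g$ is a triple $(g,\theta,\mathfrak u)$ with $g$ an inner product, $\theta\ne0$ a closed 1-form and $\mathfrak u\neq0$ a $\nabla^\theta$-flat subspace. It is adapted if $\theta|_{\mathfrak u}=0$. The orthogonal complement $\mathfrak u^\perp$ is taken with respect to $g$ (it is a Lie subalgebra for any LCP structure). *)

theory Defs
  imports "HOL-Analysis.Analysis"
begin

text \<open>
  Lie algebras, forms, inner products and representations live on subspaces of an ambient real
  vector space type; all maps are constrained on these carriers only, so that the same notions apply
  to a Lie algebra, to its subalgebras and to semidirect products.
\<close>

definition linear_map_on :: "'a::real_vector set \<Rightarrow> ('a \<Rightarrow> 'b::real_vector) \<Rightarrow> bool" where
  "linear_map_on S f \<longleftrightarrow>
     (\<forall>x\<in>S. \<forall>y\<in>S. f (x + y) = f x + f y) \<and> (\<forall>c. \<forall>x\<in>S. f (c *\<^sub>R x) = c *\<^sub>R f x)"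

locale lie_algebra =
  fixes L :: "'a::real_vector set" and br :: "'a \<Rightarrow> 'a \<Rightarrow> 'a"
  assumes subspace: "subspace L"
    and finite_dim: "\<exists>B. finite B \<and> span B = L"
    and closed: "\<lbrakk>x \<in> L; y \<in> L\<rbrakk> \<Longrightarrow> br x y \<in> L"
    and linear_left: "y \<in> L \<Longrightarrow> linear_map_on L (\<lambda>x. br x y)"
    and linear_right: "x \<in> L \<Longrightarrow> linear_map_on L (br x)"
    and alternating: "x \<in> L \<Longrightarrow> br x x = 0"
    and jacobi: "\<lbrakk>x \<in> L; y \<in> L; z \<in> L\<rbrakk> \<Longrightarrow> br x (br y z) + br y (br z x) + br z (br x y) = 0"

definition derived_algebra :: "'a::real_vector set \<Rightarrow> ('a \<Rightarrow> 'a \<Rightarrow> 'a) \<Rightarrow> 'a set" where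
  "derived_algebra L br = span {br x y | x y. x \<in> L \<and> y \<in> L}"

definition closed_one_form ::
    "'a::real_vector set \<Rightarrow> ('a \<Rightarrow> 'a \<Rightarrow> 'a) \<Rightarrow> ('a \<Rightarrow> real) \<Rightarrow> bool" where
  "closed_one_form L br \<theta> \<longleftrightarrow> linear_map_on L \<theta> \<and> (\<forall>z\<in>derived_algebra L br. \<theta> z = 0)"

text \<open>A representation of \<open>L\<close> on the subspace \<open>V\<close>.\<close>

locale lie_representation = lie_algebra L br
  for L :: "'a::real_vector set" and br :: "'a \<Rightarrow> 'a \<Rightarrow> 'a" +
  fixes V :: "'b::real_vector set" and \<rho> :: "'a \<Rightarrow> 'b \<Rightarrow> 'b"
  assumes subspace_V: "subspace V"
    and maps_to: "\<lbrakk>x \<in> L; v \<in> V\<rbrakk> \<Longrightarrow> \<rho> x v \<in> V"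
    and endo: "x \<in> L \<Longrightarrow> linear_map_on V (\<rho> x)"
    and linear_rep: "v \<in> V \<Longrightarrow> linear_map_on L (\<lambda>x. \<rho> x v)"
    and rep_br: "\<lbrakk>x \<in> L; y \<in> L; v \<in> V\<rbrakk> \<Longrightarrow> \<rho> (br x y) v = \<rho> x (\<rho> y v) - \<rho> y (\<rho> x v)"

definition orthogonal_representation ::
    "'a::real_vector set \<Rightarrow> ('a \<Rightarrow> 'a \<Rightarrow> 'a) \<Rightarrow> ('a \<Rightarrow> real ^ 'q \<Rightarrow> real ^ 'q) \<Rightarrow> bool" where
  "orthogonal_representation L br \<beta> \<longleftrightarrow>
     lie_representation L br UNIV \<beta> \<and> (\<forall>x\<in>L. \<forall>v w. \<beta> x v \<bullet> w = - (v \<bullet> \<beta> x w))"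

definition lie_isomorphic ::
    "'a::real_vector set \<Rightarrow> ('a \<Rightarrow> 'a \<Rightarrow> 'a) \<Rightarrow> 'b::real_vector set \<Rightarrow> ('b \<Rightarrow> 'b \<Rightarrow> 'b) \<Rightarrow> bool" where
  "lie_isomorphic L br L' br' \<longleftrightarrow>
     lie_algebra L br \<and> lie_algebra L' br' \<and>
     (\<exists>\<phi>. bij_betw \<phi> L L' \<and> linear_map_on L \<phi> \<and> (\<forall>x\<in>L. \<forall>y\<in>L. \<phi> (br x y) = br' (\<phi> x) (\<phi> y)))"

text \<open>
  The bracket of the semidirect product of a Lie algebra with an abelian Lie algebra \<open>V\<close> along a
  representation \<open>\<alpha>\<close>; the carrier is the Cartesian product of the two carriers.
\<close>

definition semidirect_bracket ::
    "('a \<Rightarrow> 'a \<Rightarrow> 'a) \<Rightarrow> ('a \<Rightarrow> 'b \<Rightarrow> 'b) \<Rightarrow> 'a \<times> 'b \<Rightarrow> 'a \<times> 'b \<Rightarrow> 'a \<times> 'b::real_vector" where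
  "semidirect_bracket br \<alpha> = (\<lambda>(x, v) (y, w). (br x y, \<alpha> x w - \<alpha> y v))"

definition inner_product_on :: "'a::real_vector set \<Rightarrow> ('a \<Rightarrow> 'a \<Rightarrow> real) \<Rightarrow> bool" where
  "inner_product_on L g \<longleftrightarrow>
     (\<forall>x\<in>L. linear_map_on L (g x)) \<and>
     (\<forall>x\<in>L. \<forall>y\<in>L. g x y = g y x) \<and>
     (\<forall>x\<in>L. x \<noteq> 0 \<longrightarrow> g x x > 0)"

definition orthogonal_complement ::
    "'a set \<Rightarrow> ('a \<Rightarrow> 'a \<Rightarrow> real) \<Rightarrow> 'a set \<Rightarrow> 'a set" where
  "orthogonal_complement L g U = {x \<in> L. \<forall>u\<in>U. g x u = 0}"

text \<open>
  The vector of \<open>L\<close> that is \<open>g\<close>-dual to a linear form. It exists and is unique when \<open>L\<close> is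
  finite-dimensional and \<open>g\<close> is an inner product on \<open>L\<close>.
\<close>

definition sharp :: "'a set \<Rightarrow> ('a \<Rightarrow> 'a \<Rightarrow> real) \<Rightarrow> ('a \<Rightarrow> real) \<Rightarrow> 'a" where
  "sharp L g \<theta> = (THE w. w \<in> L \<and> (\<forall>z\<in>L. g w z = \<theta> z))"

definition levi_civita ::
    "'a set \<Rightarrow> ('a \<Rightarrow> 'a \<Rightarrow> 'a) \<Rightarrow> ('a \<Rightarrow> 'a \<Rightarrow> real) \<Rightarrow> 'a \<Rightarrow> 'a \<Rightarrow> 'a" where
  "levi_civita L br g x y =
     sharp L g (\<lambda>z. 1/2 * (g (br x y) z - g (br x z) y - g (br y z) x))"

definition weyl_connection ::
    "'a::real_vector set \<Rightarrow> ('a \<Rightarrow> 'a \<Rightarrow> 'a) \<Rightarrow> ('a \<Rightarrow> 'a \<Rightarrow> real) \<Rightarrow> ('a \<Rightarrow> real) \<Rightarrow> 'a \<Rightarrow> 'a \<Rightarrow> 'a" where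
  "weyl_connection L br g \<theta> x y =
     levi_civita L br g x y + \<theta> x *\<^sub>R y + \<theta> y *\<^sub>R x - g x y *\<^sub>R sharp L g \<theta>"

text \<open>Invariance of \<open>U\<close> under the connection is part of being a representation on \<open>U\<close>.\<close>

definition flat_subspace ::
    "'a::real_vector set \<Rightarrow> ('a \<Rightarrow> 'a \<Rightarrow> 'a) \<Rightarrow> ('a \<Rightarrow> 'a \<Rightarrow> real) \<Rightarrow> ('a \<Rightarrow> real) \<Rightarrow> 'a set \<Rightarrow> bool" where
  "flat_subspace L br g \<theta> U \<longleftrightarrow>
     subspace U \<and> U \<subseteq> L \<and> lie_representation L br U (weyl_connection L br g \<theta>)"

definition LCP_structure ::
    "'a::real_vector set \<Rightarrow> ('a \<Rightarrow> 'a \<Rightarrow> 'a) \<Rightarrow> ('a \<Rightarrow> 'a \<Rightarrow> real) \<Rightarrow> ('a \<Rightarrow> real) \<Rightarrow> 'a set \<Rightarrow> bool" where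
  "LCP_structure L br g \<theta> U \<longleftrightarrow>
     inner_product_on L g \<and>
     closed_one_form L br \<theta> \<and> (\<exists>x\<in>L. \<theta> x \<noteq> 0) \<and>
     flat_subspace L br g \<theta> U \<and> U \<noteq> {0}"

definition adapted_LCP_structure ::
    "'a::real_vector set \<Rightarrow> ('a \<Rightarrow> 'a \<Rightarrow> 'a) \<Rightarrow> ('a \<Rightarrow> 'a \<Rightarrow> real) \<Rightarrow> ('a \<Rightarrow> real) \<Rightarrow> 'a set \<Rightarrow> bool" where
  "adapted_LCP_structure L br g \<theta> U \<longleftrightarrow> LCP_structure L br g \<theta> U \<and> (\<forall>u\<in>U. \<theta> u = 0)"

end

theory Submission
  imports Defs
begin

text \<open>
  The Weyl connection \<open>W\<close> is torsion-free and conformal, and its curvature vanishes on \<open>U\<close>; the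
  Bianchi identity then gives \<open>R u x = 0\<close> for \<open>u \<in> U\<close>. Let \<open>t = \<theta>\<^sup>\<sharp>\<close>. Since \<open>\<theta>\<close> vanishes on \<open>U\<close>,
  each \<open>W u\<close> is skew-symmetric and kills \<open>t\<close>, so \<open>R u t = 0\<close> reads \<open>W (W t u) = - [W u, W t]\<close>.
  As \<open>W t - \<theta>(t) Id\<close> is skew-symmetric and \<open>\<theta>(t) > 0\<close>, taking the trace form of both sides with
  \<open>W u\<close> forces \<open>W u = 0\<close>. By torsion-freeness \<open>[x, u] = W x u\<close> for all \<open>x\<close>; so \<open>U\<close> is an abelian
  ideal, and \<open>x \<mapsto> W x\<close>, restricted to \<open>U\<^sup>\<bottom>\<close>, is the required representation with \<open>\<xi> = \<theta>\<close>.
\<close>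

section \<open>Linear maps on carrier subspaces, and finite dimension\<close>

lemma linear_map_onI:
  assumes "\<And>x y. x \<in> S \<Longrightarrow> y \<in> S \<Longrightarrow> f (x + y) = f x + f y"
    and "\<And>c x. x \<in> S \<Longrightarrow> f (c *\<^sub>R x) = c *\<^sub>R f x"
  shows "linear_map_on S f"
  using assms by (auto simp: linear_map_on_def)

lemma linear_map_on_add: "linear_map_on S f \<Longrightarrow> x \<in> S \<Longrightarrow> y \<in> S \<Longrightarrow> f (x + y) = f x + f y"
  by (auto simp: linear_map_on_def)

lemma linear_map_on_scale: "linear_map_on S f \<Longrightarrow> x \<in> S \<Longrightarrow> f (c *\<^sub>R x) = c *\<^sub>R f x"
  by (auto simp: linear_map_on_def)

lemma linear_map_on_zero:
  assumes "linear_map_on S f" "subspace S" shows "f 0 = 0"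
  using linear_map_on_scale[OF assms(1), of 0 0] subspace_0[OF assms(2)] by simp

lemma linear_map_on_minus:
  assumes "linear_map_on S f" "x \<in> S" shows "f (- x) = - f x"
  using linear_map_on_scale[OF assms, of "-1"] by simp

lemma linear_map_on_diff:
  assumes "linear_map_on S f" "subspace S" "x \<in> S" "y \<in> S" shows "f (x - y) = f x - f y"
  using linear_map_on_add[OF assms(1,3), of "- y"] linear_map_on_minus[OF assms(1,4)]
    subspace_neg[OF assms(2,4)] by simp

lemma linear_map_on_sum:
  assumes "linear_map_on S f" "subspace S" "\<And>i. i \<in> I \<Longrightarrow> x i \<in> S"
  shows "f (\<Sum>i\<in>I. c i *\<^sub>R x i) = (\<Sum>i\<in>I. c i *\<^sub>R f (x i))"
  using assms(3)
proof (induction I rule: infinite_finite_induct)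
  case (insert i I)
  have "(\<Sum>i\<in>I. c i *\<^sub>R x i) \<in> S"
    using insert.prems by (intro subspace_sum[OF assms(2)] subspace_scale[OF assms(2)]) auto
  with insert show ?case
    by (simp add: linear_map_on_add[OF assms(1)] linear_map_on_scale[OF assms(1)]
        subspace_scale[OF assms(2)])
\<comment> \<open>For empty or infinite \<open>I\<close> both sums are \<open>0\<close>, so
  \<open>f 0 = 0\<close> settles these cases.\<close>
qed (use linear_map_on_zero[OF assms(1,2)] in auto)

lemma linear_map_on_subset: "linear_map_on S f \<Longrightarrow> T \<subseteq> S \<Longrightarrow> linear_map_on T f"
  unfolding linear_map_on_def by blast

text \<open>A maximal independent subset of \<open>S\<close> spans \<open>S\<close>, and it is
  finite because independent vectors in the span of a finite set cannot outnumber that set.\<close>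

lemma subspace_finite_dim:
  fixes S V :: "'a::real_vector set"
  assumes "subspace S" "S \<subseteq> V" "\<exists>B. finite B \<and> span B = V"
  shows "\<exists>B. finite B \<and> span B = S"
proof -
  obtain B where B: "finite B" "span B = V" using assms(3) by blast
  obtain A where A: "A \<subseteq> S" "independent A" "S \<subseteq> span A"
    using maximal_independent_subset[of S] by metis
  have "finite A"
    using independent_span_bound[OF B(1) A(2)] A(1) assms(2) B(2) by auto
  moreover have "span A = S"
    using A assms(1) by (simp add: span_minimal subset_antisym)
  ultimately show ?thesis by blast
qed

section \<open>Semidirect products with an abelian Lie algebra\<close>

text \<open>The first component of the Jacobi identity is that of \<open>H\<close>; in the second,
  the terms cancel because \<open>\<alpha>\<close> turns brackets into commutators.\<close>

lemma lie_algebra_semidirect: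
  fixes \<alpha> :: "'a::real_vector \<Rightarrow> 'b::euclidean_space \<Rightarrow> 'b"
  assumes "lie_representation H br UNIV \<alpha>"
  shows "lie_algebra (H \<times> UNIV) (semidirect_bracket br \<alpha>)"
proof -
  interpret lie_representation H br UNIV \<alpha> by fact
  have add: "br x (y + z) = br x y + br x z" "br (y + z) x = br y x + br z x"
    "\<alpha> (y + z) v = \<alpha> y v + \<alpha> z v" if "x \<in> H" "y \<in> H" "z \<in> H" for x y z v
    using linear_map_on_add[OF linear_left] linear_map_on_add[OF linear_right]
      linear_map_on_add[OF linear_rep] that by simp_all
  have scale: "br x (c *\<^sub>R y) = c *\<^sub>R br x y" "br (c *\<^sub>R y) x = c *\<^sub>R br y x"
    "\<alpha> (c *\<^sub>R y) v = c *\<^sub>R \<alpha> y v" if "x \<in> H" "y \<in> H" for x y v c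
    using linear_map_on_scale[OF linear_left] linear_map_on_scale[OF linear_right]
      linear_map_on_scale[OF linear_rep] that by simp_all
  have \<alpha>: "\<alpha> x (v + w) = \<alpha> x v + \<alpha> x w" "\<alpha> x (c *\<^sub>R v) = c *\<^sub>R \<alpha> x v"
    "\<alpha> x (v - w) = \<alpha> x v - \<alpha> x w" if "x \<in> H" for x v w c
    using linear_map_on_add[OF endo[OF that]] linear_map_on_scale[OF endo[OF that]]
      linear_map_on_diff[OF endo[OF that] subspace_UNIV] by simp_all
  obtain B where B: "finite B" "span B = H" using finite_dim by blast
  have "span (B \<times> {0} \<union> {0} \<times> Basis) = H \<times> (UNIV :: 'b set)"
  proof -
    have "span (B \<times> {0} \<union> {0} \<times> Basis)
      = {x + y |x y. x \<in> span B \<times> {0} \<and> y \<in> {0} \<times> span (Basis :: 'b set)}"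
      by (simp only: span_Un span_Times_sing1 span_Times_sing2)
    also have "\<dots> = H \<times> UNIV" using B by force
    finally show ?thesis .
  qed
  moreover have "finite (B \<times> {0} \<union> {0} \<times> (Basis :: 'b set))" using B by simp
  ultimately have fd: "\<exists>C. finite C \<and> span C = H \<times> (UNIV :: 'b set)" by blast
  show ?thesis
  proof
    show "subspace (H \<times> (UNIV :: 'b set))" using subspace by (rule subspace_Times) simp
    fix p q r :: "'a \<times> 'b"
    assume p: "p \<in> H \<times> UNIV"
    show "linear_map_on (H \<times> UNIV) (\<lambda>q. semidirect_bracket br \<alpha> q p)"
      "linear_map_on (H \<times> UNIV) (semidirect_bracket br \<alpha> p)"
      using p by (auto intro!: linear_map_onI
          simp: semidirect_bracket_def add scale \<alpha> scaleR_diff_right algebra_simps)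
    show "semidirect_bracket br \<alpha> p p = 0"
      using p by (auto simp: semidirect_bracket_def alternating zero_prod_def)
    assume q: "q \<in> H \<times> UNIV"
    show "semidirect_bracket br \<alpha> p q \<in> H \<times> UNIV"
      using p q by (auto simp: semidirect_bracket_def closed)
    assume r: "r \<in> H \<times> UNIV"
    show "semidirect_bracket br \<alpha> p (semidirect_bracket br \<alpha> q r)
      + semidirect_bracket br \<alpha> q (semidirect_bracket br \<alpha> r p)
      + semidirect_bracket br \<alpha> r (semidirect_bracket br \<alpha> p q) = 0"
      using p q r by (auto simp: semidirect_bracket_def jacobi rep_br \<alpha> zero_prod_def)
  qed (fact fd)
qed

section \<open>Inner products on a carrier: orthonormal bases, dual vectors and traces\<close>

locale inner_product_space =
  fixes L :: "'a::real_vector set" and g :: "'a \<Rightarrow> 'a \<Rightarrow> real"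
  assumes subspace_L: "subspace L"
    and finite_dim_L: "\<exists>B. finite B \<and> span B = L"
    and inner_product: "inner_product_on L g"
begin

lemmas in_L = subspace_0[OF subspace_L] subspace_add[OF subspace_L] subspace_diff[OF subspace_L]
  subspace_scale[OF subspace_L] subspace_neg[OF subspace_L]

lemma g_linear: "x \<in> L \<Longrightarrow> linear_map_on L (g x)"
  using inner_product by (auto simp: inner_product_on_def)

lemma g_commute: "x \<in> L \<Longrightarrow> y \<in> L \<Longrightarrow> g x y = g y x"
  using inner_product by (auto simp: inner_product_on_def)

lemma g_right:
  assumes "x \<in> L" "y \<in> L"
  shows "z \<in> L \<Longrightarrow> g x (y + z) = g x y + g x z" "z \<in> L \<Longrightarrow> g x (y - z) = g x y - g x z"
    "g x (c *\<^sub>R y) = c * g x y" "g x (- y) = - g x y"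
  using assms g_linear[OF assms(1)] linear_map_on_diff[OF _ subspace_L]
  by (auto simp: linear_map_on_add linear_map_on_minus linear_map_on_scale)

lemma g_zero: "x \<in> L \<Longrightarrow> g x 0 = 0" "x \<in> L \<Longrightarrow> g 0 x = 0"
  using linear_map_on_zero[OF g_linear subspace_L] by (auto simp: g_commute[of 0 x] in_L)

lemma g_left:
  assumes "x \<in> L" "y \<in> L"
  shows "z \<in> L \<Longrightarrow> g (y + z) x = g y x + g z x" "z \<in> L \<Longrightarrow> g (y - z) x = g y x - g z x"
    "g (c *\<^sub>R y) x = c * g y x" "g (- y) x = - g y x"
  using assms g_right[OF assms] by (simp_all add: g_commute in_L)

lemma g_sum_left:
  assumes "y \<in> L" "\<And>i. i \<in> I \<Longrightarrow> x i \<in> L"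
  shows "g (\<Sum>i\<in>I. c i *\<^sub>R x i) y = (\<Sum>i\<in>I. c i * g (x i) y)"
proof -
  have "(\<Sum>i\<in>I. c i *\<^sub>R x i) \<in> L"
    using assms(2) by (intro subspace_sum[OF subspace_L] in_L) auto
  then have "g (\<Sum>i\<in>I. c i *\<^sub>R x i) y = g y (\<Sum>i\<in>I. c i *\<^sub>R x i)"
    using assms by (simp add: g_commute)
  also have "\<dots> = (\<Sum>i\<in>I. c i *\<^sub>R g y (x i))"
    by (rule linear_map_on_sum[OF g_linear[OF assms(1)] subspace_L assms(2)])
  finally show ?thesis using assms by (simp add: g_commute)
qed

lemma g_pos: "x \<in> L \<Longrightarrow> x \<noteq> 0 \<Longrightarrow> g x x > 0"
  using inner_product by (auto simp: inner_product_on_def)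

lemma g_nonneg: "x \<in> L \<Longrightarrow> g x x \<ge> 0"
  using g_pos[of x] g_zero(1)[of x] by (cases "x = 0") auto

lemma g_eq_0: "x \<in> L \<Longrightarrow> g x x = 0 \<Longrightarrow> x = 0"
  using g_pos[of x] by force

text \<open>Nondegeneracy, in the form that suits vectors known only through their pairings, as
  those produced by \<open>sharp\<close> are.\<close>

lemma g_eqI:
  assumes "x \<in> L" "y \<in> L" "\<And>z. z \<in> L \<Longrightarrow> g x z = g y z"
  shows "x = y"
proof -
  have "g (x - y) (x - y) = 0"
    using assms by (simp add: g_left in_L)
  then show ?thesis using g_eq_0[of "x - y"] assms by (simp add: in_L)
qed

definition orthonormal_basis :: "'a set \<Rightarrow> 'a set \<Rightarrow> bool" where
  "orthonormal_basis E V \<longleftrightarrow> finite E \<and> E \<subseteq> L \<and> span E = V \<and>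
     (\<forall>e\<in>E. \<forall>f\<in>E. g e f = (if e = f then 1 else 0))"

lemma orthonormal_basis_subset: "orthonormal_basis E V \<Longrightarrow> E \<subseteq> V"
  unfolding orthonormal_basis_def using span_superset by blast

text \<open>Gram-Schmidt: \<open>p\<close> is the projection of the new vector \<open>b\<close> to
  the span of \<open>E\<close>. If the remainder \<open>w\<close> vanishes, \<open>b\<close> is
  redundant; otherwise \<open>w\<close> is normalised and added to \<open>E\<close>.\<close>

lemma orthonormal_basis_span:
  assumes "finite B" "B \<subseteq> L"
  shows "\<exists>E. orthonormal_basis E (span B)"
  using assms
proof (induction B rule: finite_induct)
  case empty
  show ?case by (rule exI[of _ "{}"]) (simp add: orthonormal_basis_def)
next
  case (insert b B)
  then obtain E where E: "orthonormal_basis E (span B)" by auto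
  then have fin: "finite E" and EL: "E \<subseteq> L" and sp: "span E = span B"
    and on: "\<And>e f. e \<in> E \<Longrightarrow> f \<in> E \<Longrightarrow> g e f = (if e = f then 1 else 0)"
    by (auto simp: orthonormal_basis_def)
  have bL: "b \<in> L" using insert by auto
  define p where "p = (\<Sum>e\<in>E. g b e *\<^sub>R e)"
  define w where "w = b - p"
  have pE: "p \<in> span E"
    unfolding p_def by (intro span_sum span_scale span_base)
  have pL: "p \<in> L"
    unfolding p_def using EL by (intro subspace_sum[OF subspace_L] in_L) auto
  have wL: "w \<in> L" by (simp add: w_def bL pL in_L)
  have orth: "g w f = 0" if "f \<in> E" for f
  proof -
    have fL: "f \<in> L" using that EL by auto
    have "g p f = (\<Sum>e\<in>E. g b e * g e f)"
      unfolding p_def by (rule g_sum_left) (use fL EL in auto)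
    also have "\<dots> = (\<Sum>e\<in>E. if e = f then g b e else 0)"
      using that on by (intro sum.cong) auto
    also have "\<dots> = g b f" using fin that by simp
    finally show ?thesis by (simp add: w_def g_left fL bL pL)
  qed
  have spb: "span (insert b B) = span (insert b E)"
    by (simp add: span_insert sp)
  show ?case
  proof (cases "w = 0")
    case True
    then have "b \<in> span E" using pE by (simp add: w_def)
    then have "span (insert b B) = span B"
      using spb sp by (simp add: span_redundant)
    then show ?thesis using E by auto
  next
    case False
    define c where "c = 1 / sqrt (g w w)"
    have gw: "g w w > 0" using g_pos[OF wL False] .
    have c0: "c \<noteq> 0" using gw by (simp add: c_def)
    have cc: "c * (c * g w w) = 1"
      using gw by (simp add: c_def field_simps)
    \<comment> \<open>Up to the nonzero factor \<open>c\<close>, the two new generators differ only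
      by \<open>p\<close>, which lies in the span of \<open>E\<close>.\<close>
    have "span (insert b E) = span (insert (c *\<^sub>R w) E)"
    proof (rule subset_antisym; rule span_minimal[OF _ subspace_span])
      have 1: "c *\<^sub>R w \<in> span (insert (c *\<^sub>R w) E)" by (simp add: span_base)
      have "p \<in> span (insert (c *\<^sub>R w) E)" using pE span_mono subset_insertI by blast
      moreover have "w \<in> span (insert (c *\<^sub>R w) E)"
        using span_scale[OF 1, of "1 / c"] c0 by simp
      ultimately have "w + p \<in> span (insert (c *\<^sub>R w) E)" by (simp add: span_add)
      then show "insert b E \<subseteq> span (insert (c *\<^sub>R w) E)"
        by (auto simp: w_def intro: span_base)
      have "p \<in> span (insert b E)" using pE span_mono subset_insertI by blast
      then show "insert (c *\<^sub>R w) E \<subseteq> span (insert b E)"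
        by (auto simp: w_def intro!: span_scale span_diff intro: span_base)
    qed
    moreover have n: "g (c *\<^sub>R w) (c *\<^sub>R w) = 1"
      using wL cc by (simp add: g_left g_right in_L)
    moreover have o: "g (c *\<^sub>R w) f = 0" "g f (c *\<^sub>R w) = 0" if "f \<in> E" for f
      using that orth[OF that] EL wL by (auto simp: g_left g_right in_L g_commute[of f w])
    moreover have "c *\<^sub>R w \<notin> E" using n o(1) by force
    ultimately have "orthonormal_basis (insert (c *\<^sub>R w) E) (span (insert b B))"
      unfolding orthonormal_basis_def using fin EL wL on spb
      by (auto simp: in_L)
    then show ?thesis by blast
  qed
qed

lemma orthonormal_basis_exists:
  assumes "subspace V" "V \<subseteq> L"
  shows "\<exists>E. orthonormal_basis E V"
proof -
  obtain B where B: "finite B" "span B = V"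
    using subspace_finite_dim[OF assms finite_dim_L] by blast
  then have "B \<subseteq> L" using span_superset assms(2) by blast
  then show ?thesis using orthonormal_basis_span[OF B(1)] B(2) by simp
qed

text \<open>Pairing any expansion of \<open>v\<close> over \<open>E\<close> with a basis vector
  reads off the coefficient of that vector.\<close>

lemma orthonormal_expansion:
  assumes E: "orthonormal_basis E V" and v: "v \<in> V"
  shows "v = (\<Sum>e\<in>E. g v e *\<^sub>R e)"
proof -
  have fin: "finite E" and EL: "E \<subseteq> L" and sp: "span E = V"
    and on: "\<And>e f. e \<in> E \<Longrightarrow> f \<in> E \<Longrightarrow> g e f = (if e = f then 1 else 0)"
    using E by (auto simp: orthonormal_basis_def)
  obtain c where c: "v = (\<Sum>e\<in>E. c e *\<^sub>R e)"
    using v span_finite[OF fin] sp by auto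
  have "g v f = c f" if "f \<in> E" for f
  proof -
    have fL: "f \<in> L" using that EL by auto
    have "g v f = (\<Sum>e\<in>E. c e * g e f)"
      unfolding c by (rule g_sum_left) (use fL EL in auto)
    also have "\<dots> = (\<Sum>e\<in>E. if e = f then c e else 0)"
      using that on by (intro sum.cong) auto
    also have "\<dots> = c f" using fin that by simp
    finally show ?thesis .
  qed
  then show ?thesis by (simp add: c)
qed

text \<open>Pairing a vanishing combination with a basis vector shows that its coefficient is zero,
  so \<open>E\<close> is independent. This links \<open>dim U\<close> to the number of coordinates
  later on.\<close>

lemma card_orthonormal_basis:
  assumes E: "orthonormal_basis E V"
  shows "card E = dim V"
proof -
  have fin: "finite E" and EL: "E \<subseteq> L" and sp: "span E = V"
    and on: "\<And>e f. e \<in> E \<Longrightarrow> f \<in> E \<Longrightarrow> g e f = (if e = f then 1 else 0)"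
    using E by (auto simp: orthonormal_basis_def)
  have "independent E"
  proof (rule independent_if_scalars_zero[OF fin])
    fix c f assume 0: "(\<Sum>e\<in>E. c e *\<^sub>R e) = 0" and f: "f \<in> E"
    have fL: "f \<in> L" using f EL by auto
    have "c f = (\<Sum>e\<in>E. if e = f then c e else 0)" using fin f by simp
    also have "\<dots> = (\<Sum>e\<in>E. c e * g e f)"
      using f on by (intro sum.cong) auto
    also have "\<dots> = g (\<Sum>e\<in>E. c e *\<^sub>R e) f"
      by (rule g_sum_left[symmetric]) (use fL EL in auto)
    also have "\<dots> = 0" using 0 g_zero(2)[OF fL] by simp
    finally show "c f = 0" .
  qed
  then show ?thesis using dim_span_eq_card_independent sp by metis
qed

text \<open>Riesz representation: the dual vector is the sum of
  \<open>\<theta> e *\<^sub>R e\<close> over an orthonormal basis. Existence and uniqueness together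
  make the definite description in \<open>sharp\<close> meaningful.\<close>

lemma
  assumes "linear_map_on L \<theta>"
  shows sharp_in: "sharp L g \<theta> \<in> L" and g_sharp: "z \<in> L \<Longrightarrow> g (sharp L g \<theta>) z = \<theta> z"
proof -
  obtain E where E: "orthonormal_basis E L"
    using orthonormal_basis_exists[OF subspace_L] by blast
  have EL: "E \<subseteq> L" using E by (auto simp: orthonormal_basis_def)
  define w where "w = (\<Sum>e\<in>E. \<theta> e *\<^sub>R e)"
  have wL: "w \<in> L"
    unfolding w_def using EL by (intro subspace_sum[OF subspace_L] in_L) auto
  have gw: "g w z = \<theta> z" if z: "z \<in> L" for z
  proof -
    have "g w z = (\<Sum>e\<in>E. \<theta> e * g e z)"
      unfolding w_def by (rule g_sum_left) (use z EL in auto)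
    also have "\<dots> = (\<Sum>e\<in>E. g z e *\<^sub>R \<theta> e)"
      using EL z by (intro sum.cong) (auto simp: g_commute)
    also have "\<dots> = \<theta> (\<Sum>e\<in>E. g z e *\<^sub>R e)"
      by (rule linear_map_on_sum[OF assms subspace_L, symmetric]) (use EL in auto)
    also have "\<dots> = \<theta> z" using orthonormal_expansion[OF E z] by simp
    finally show ?thesis .
  qed
  have "\<exists>!w. w \<in> L \<and> (\<forall>z\<in>L. g w z = \<theta> z)"
    using wL gw by (intro ex1I[of _ w]) (auto intro: g_eqI)
  then have "sharp L g \<theta> \<in> L \<and> (\<forall>z\<in>L. g (sharp L g \<theta>) z = \<theta> z)"
    unfolding sharp_def by (rule theI')
  then show "sharp L g \<theta> \<in> L" "z \<in> L \<Longrightarrow> g (sharp L g \<theta>) z = \<theta> z" by auto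
qed

text \<open>The trace of the product of a skew-symmetric and a symmetric matrix is zero: exchanging
  the two summation indices changes the sign of the sum.\<close>

lemma skew_symmetric_trace:
  assumes E: "orthonormal_basis E V" and V: "subspace V"
    and T: "\<And>e. e \<in> E \<Longrightarrow> T e \<in> V"
    and skew: "\<And>e f. e \<in> E \<Longrightarrow> f \<in> E \<Longrightarrow> g (T e) f = - g (T f) e"
    and lin: "\<And>e. e \<in> E \<Longrightarrow> linear_map_on V (\<lambda>v. b v e)"
    and sym: "\<And>e f. e \<in> E \<Longrightarrow> f \<in> E \<Longrightarrow> b e f = (b f e :: real)"
  shows "(\<Sum>e\<in>E. b (T e) e) = 0"
proof -
  let ?s = "\<Sum>e\<in>E. \<Sum>f\<in>E. g (T e) f * b f e"
  have EV: "E \<subseteq> V" using orthonormal_basis_subset[OF E] .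
  have "b (T e) e = (\<Sum>f\<in>E. g (T e) f * b f e)" if e: "e \<in> E" for e
  proof -
    have "b (T e) e = b (\<Sum>f\<in>E. g (T e) f *\<^sub>R f) e"
      using orthonormal_expansion[OF E T[OF e]] by simp
    also have "\<dots> = (\<Sum>f\<in>E. g (T e) f *\<^sub>R b f e)"
      by (rule linear_map_on_sum[OF lin[OF e] V]) (use EV in auto)
    finally show ?thesis by simp
  qed
  then have s: "(\<Sum>e\<in>E. b (T e) e) = ?s" by simp
  have "?s = (\<Sum>e\<in>E. \<Sum>f\<in>E. - (g (T f) e * b e f))"
  proof (intro sum.cong refl)
    fix e f assume "e \<in> E" "f \<in> E"
    then show "g (T e) f * b f e = - (g (T f) e * b e f)"
      using skew[of e f] sym[of e f] by simp
  qed
  also have "\<dots> = - (\<Sum>f\<in>E. \<Sum>e\<in>E. g (T f) e * b e f)"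
    by (subst sum.swap) (simp add: sum_negf)
  finally show ?thesis using s by simp
qed

end

section \<open>The Weyl connection of a closed form, and its curvature\<close>

locale weyl_lie_algebra = lie_algebra L br + inner_product_space L g
  for L :: "'a::real_vector set" and br g +
  fixes \<theta> :: "'a \<Rightarrow> real"
  assumes closed_form: "closed_one_form L br \<theta>"
begin

abbreviation W :: "'a \<Rightarrow> 'a \<Rightarrow> 'a" where
  "W \<equiv> weyl_connection L br g \<theta>"

text \<open>The curvature of \<open>W\<close>; it measures the failure of \<open>W\<close> to be a
  representation.\<close>

definition R :: "'a \<Rightarrow> 'a \<Rightarrow> 'a \<Rightarrow> 'a" where
  "R x y z = W x (W y z) - W y (W x z) - W (br x y) z"

lemma br_right:
  assumes "x \<in> L" "y \<in> L"
  shows "z \<in> L \<Longrightarrow> br x (y + z) = br x y + br x z" "br x (c *\<^sub>R y) = c *\<^sub>R br x y"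
  using linear_right[OF assms(1)] assms(2)
  by (auto simp: linear_map_on_add linear_map_on_scale)

lemma br_left:
  assumes "x \<in> L" "y \<in> L"
  shows "z \<in> L \<Longrightarrow> br (y + z) x = br y x + br z x" "br (c *\<^sub>R y) x = c *\<^sub>R br y x"
  using linear_map_on_add[OF linear_left[OF assms(1)] assms(2)]
    linear_map_on_scale[OF linear_left[OF assms(1)] assms(2)] by auto

lemma br_anticommute:
  assumes "x \<in> L" "y \<in> L" shows "br x y = - br y x"
proof -
  have "br (x + y) (x + y) = br x (x + y) + br y (x + y)"
    using assms by (simp only: br_left in_L)
  also have "\<dots> = br x y + br y x"
    using assms by (simp add: br_right alternating)
  finally have "br x y + br y x = 0" using alternating[of "x + y"] assms by (simp add: in_L)
  then show ?thesis by (simp add: eq_neg_iff_add_eq_0)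
qed

lemma form_linear: "linear_map_on L \<theta>"
  using closed_form by (simp add: closed_one_form_def)

lemma form_br: "x \<in> L \<Longrightarrow> y \<in> L \<Longrightarrow> \<theta> (br x y) = 0"
  using closed_form unfolding closed_one_form_def derived_algebra_def
  by (blast intro: span_base)

lemmas form_simps = linear_map_on_add[OF form_linear] linear_map_on_scale[OF form_linear]
  linear_map_on_diff[OF form_linear subspace_L] linear_map_on_minus[OF form_linear]

text \<open>Needed for the dual vector in \<open>levi_civita\<close> to exist.\<close>

lemma koszul_linear:
  assumes "x \<in> L" "y \<in> L"
  shows "linear_map_on L (\<lambda>z. 1/2 * (g (br x y) z - g (br x z) y - g (br y z) x))"
  using assms
  by (intro linear_map_onI) (simp_all add: g_left g_right br_right closed in_L algebra_simps)

lemma W_in [simp]: "x \<in> L \<Longrightarrow> y \<in> L \<Longrightarrow> W x y \<in> L"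
  unfolding weyl_connection_def levi_civita_def
  by (intro in_L sharp_in koszul_linear form_linear)

text \<open>The Koszul formula with its conformal correction. Apart from \<open>W_in\<close>, the
  definition of \<open>W\<close> enters the sequel only through this identity.\<close>

lemma g_W:
  assumes "x \<in> L" "y \<in> L" "z \<in> L"
  shows "g (W x y) z = 1/2 * (g (br x y) z - g (br x z) y - g (br y z) x)
    + \<theta> x * g y z + \<theta> y * g x z - g x y * \<theta> z"
proof -
  have "levi_civita L br g x y \<in> L"
    and "g (levi_civita L br g x y) z = 1/2 * (g (br x y) z - g (br x z) y - g (br y z) x)"
    using sharp_in[OF koszul_linear[OF assms(1,2)]] g_sharp[OF koszul_linear[OF assms(1,2)] assms(3)]
    by (simp_all only: levi_civita_def)
  then show ?thesis
    using assms
    by (simp add: weyl_connection_def g_left in_L sharp_in[OF form_linear] g_sharp[OF form_linear])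
qed

lemma W_linear_right:
  assumes "x \<in> L" shows "linear_map_on L (W x)"
  using assms
  by (intro linear_map_onI g_eqI)
    (simp_all add: g_left g_right g_W br_left br_right closed in_L form_simps algebra_simps)

lemma W_linear_left:
  assumes "y \<in> L" shows "linear_map_on L (\<lambda>x. W x y)"
  using assms
  by (intro linear_map_onI g_eqI)
    (simp_all add: g_left g_right g_W br_left br_right closed in_L form_simps algebra_simps)

lemma W_right:
  assumes "x \<in> L" "y \<in> L"
  shows "z \<in> L \<Longrightarrow> W x (y + z) = W x y + W x z" "z \<in> L \<Longrightarrow> W x (y - z) = W x y - W x z"
    "W x (c *\<^sub>R y) = c *\<^sub>R W x y" "W x (- y) = - W x y"
  using W_linear_right[OF assms(1)] assms linear_map_on_diff[OF _ subspace_L]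
  by (auto simp: linear_map_on_add linear_map_on_minus linear_map_on_scale)

lemma W_left:
  assumes "x \<in> L" "y \<in> L"
  shows "z \<in> L \<Longrightarrow> W (y + z) x = W y x + W z x" "z \<in> L \<Longrightarrow> W (y - z) x = W y x - W z x"
    "W (c *\<^sub>R y) x = c *\<^sub>R W y x" "W (- y) x = - W y x"
  using linear_map_on_add[OF W_linear_left[OF assms(1)] assms(2)]
    linear_map_on_scale[OF W_linear_left[OF assms(1)] assms(2)]
    linear_map_on_diff[OF W_linear_left[OF assms(1)] subspace_L assms(2)]
    linear_map_on_minus[OF W_linear_left[OF assms(1)] assms(2)] by auto

text \<open>In \<open>g_W\<close> the terms with \<open>\<theta>\<close> are together symmetric in
  \<open>x\<close> and \<open>y\<close>, and so are the last two Koszul terms together; only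
  \<open>g (br x y) z\<close> survives in the difference.\<close>

lemma W_torsion:
  assumes "x \<in> L" "y \<in> L" shows "W x y - W y x = br x y"
proof (rule g_eqI)
  fix z assume "z \<in> L"
  then show "g (W x y - W y x) z = g (br x y) z"
    using assms
    by (simp add: g_left g_W closed br_anticommute[of y x] g_commute[of y x] field_simps)
qed (use assms in \<open>simp_all add: in_L closed\<close>)

text \<open>Equivalently, \<open>W x\<close> minus \<open>\<theta> x\<close> times the identity is
  skew-symmetric. The skewness of \<open>R\<close>, that of \<open>S\<close> in
  \<open>W_U_zero\<close> and the orthogonality of \<open>\<beta>\<close> all rest on this.\<close>

lemma W_metric:
  assumes "x \<in> L" "y \<in> L" "z \<in> L"
  shows "g (W x y) z + g y (W x z) = 2 * \<theta> x * g y z"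
  using assms
  by (simp add: g_commute[of y "W x z"] g_W br_anticommute[of z y] g_left closed
      g_commute[of z y] algebra_simps)

lemma R_in: "x \<in> L \<Longrightarrow> y \<in> L \<Longrightarrow> z \<in> L \<Longrightarrow> R x y z \<in> L"
  unfolding R_def by (intro in_L W_in closed)

text \<open>The scalar parts of \<open>W x\<close> and \<open>W y\<close> drop out of their
  commutator, and \<open>W (br x y)\<close> has no scalar part because \<open>\<theta>\<close>
  vanishes on brackets.\<close>

lemma R_skew:
  assumes "x \<in> L" "y \<in> L" "z \<in> L" "w \<in> L"
  shows "g (R x y z) w = - g z (R x y w)"
proof -
  have "g (W x (W y z)) w = 2 * \<theta> x * g (W y z) w - 2 * \<theta> y * g z (W x w) + g z (W y (W x w))"
    using W_metric[of x "W y z" w] W_metric[of y z "W x w"] assms by simp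
  moreover have
    "g (W y (W x z)) w = 2 * \<theta> y * g (W x z) w - 2 * \<theta> x * g z (W y w) + g z (W x (W y w))"
    using W_metric[of y "W x z" w] W_metric[of x z "W y w"] assms by simp
  moreover have "g (W (br x y) z) w = - g z (W (br x y) w)"
    using W_metric[of "br x y" z w] assms by (simp add: closed form_br)
  \<comment> \<open>Both sides equal \<open>2 * \<theta> x * \<theta> y * g z w\<close>. This
    cancels the scalar contributions when the two expansions above are subtracted.\<close>
  moreover have "\<theta> x * (g (W y z) w + g z (W y w)) = \<theta> y * (g (W x z) w + g z (W x w))"
    using assms by (simp add: W_metric)
  ultimately show ?thesis
    using assms by (simp add: R_def g_left g_right closed in_L algebra_simps)
qed

text \<open>Using \<open>W_torsion\<close> twice turns the cyclic sum of curvatures into a cyclic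
  sum of double brackets, which is zero by the Jacobi identity.\<close>

lemma R_bianchi:
  assumes "x \<in> L" "y \<in> L" "z \<in> L"
  shows "R x y z + R y z x + R z x y = 0"
proof -
  have "W a (W b c) - W a (W c b) = W a (br b c)" if "a \<in> L" "b \<in> L" "c \<in> L" for a b c
    using that by (simp flip: W_torsion W_right(2))
  from this[of x y z] this[of y z x] this[of z x y] assms
  have "R x y z + R y z x + R z x y
    = (W x (br y z) - W (br y z) x) + (W y (br z x) - W (br z x) y) + (W z (br x y) - W (br x y) z)"
    by (simp add: R_def algebra_simps)
  also have "\<dots> = 0"
    using assms jacobi[of x y z] by (simp add: W_torsion closed)
  finally show ?thesis .
qed

lemma R_antisym:
  assumes "x \<in> L" "y \<in> L" "z \<in> L" shows "R x y z = - R y x z"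
  using assms br_anticommute[of x y] by (simp add: R_def W_left closed)

end

section \<open>Adapted LCP structures: the operators \<open>W u\<close> vanish for \<open>u\<close>
  in \<open>U\<close>\<close>

locale adapted_LCP_lie_algebra = weyl_lie_algebra L br g \<theta>
  for L :: "'a::real_vector set" and br g \<theta> +
  fixes U :: "'a set"
  assumes form_nonzero: "\<exists>x\<in>L. \<theta> x \<noteq> 0"
    and flat: "flat_subspace L br g \<theta> U"
    and adapted: "u \<in> U \<Longrightarrow> \<theta> u = 0"
begin

lemma U_subspace: "subspace U"
  using flat by (simp add: flat_subspace_def)

lemma U_in_L: "u \<in> U \<Longrightarrow> u \<in> L"
  using flat by (auto simp: flat_subspace_def)

lemma W_U: "x \<in> L \<Longrightarrow> u \<in> U \<Longrightarrow> W x u \<in> U"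
  using flat by (auto simp: flat_subspace_def intro: lie_representation.maps_to)

text \<open>Vanishing curvature on \<open>U\<close> is the bracket identity of the representation
  \<open>W\<close> on \<open>U\<close>.\<close>

lemma R_U: "x \<in> L \<Longrightarrow> y \<in> L \<Longrightarrow> u \<in> U \<Longrightarrow> R x y u = 0"
  using flat by (auto simp: flat_subspace_def R_def lie_representation.rep_br)

text \<open>By the Bianchi identity \<^term>\<open>g (R u x y) z\<close> is symmetric in \<open>x\<close>, \<open>y\<close>; it is skew-symmetric in
  \<open>y\<close>, \<open>z\<close>, hence zero.\<close>

lemma R_U_left:
  assumes u: "u \<in> U" and x: "x \<in> L" and y: "y \<in> L"
  shows "R u x y = 0"
proof -
  have uL: "u \<in> L" using u by (rule U_in_L)
  have sym: "R u a b = R u b a" if "a \<in> L" "b \<in> L" for a b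
    using R_bianchi[of a b u] R_U[of a b u] R_antisym[of b u a] that u uL by simp
  have skew: "g (R u a b) c = - g (R u a c) b" if "a \<in> L" "b \<in> L" "c \<in> L" for a b c
    using R_skew[OF uL that] that uL by (simp add: g_commute R_in)
  show ?thesis
  proof (rule g_eqI)
    fix z assume z: "z \<in> L"
    have "g (R u x y) z = - g (R u x y) z"
      using skew[OF x y z] skew[OF y x z] skew[OF z x y] sym[OF x y] sym[OF y z] sym[OF z x]
      by simp
    then show "g (R u x y) z = g 0 z" using z g_zero(2)[OF z] by simp
  qed (use uL x y in \<open>simp_all add: R_in in_L\<close>)
qed

definition t :: 'a where "t = sharp L g \<theta>"

lemma t_in: "t \<in> L" and g_t: "z \<in> L \<Longrightarrow> g t z = \<theta> z"
  unfolding t_def by (simp_all add: sharp_in g_sharp form_linear)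

text \<open>The value is the squared length of \<open>t\<close>, and \<open>t\<close> is nonzero
  because \<open>\<theta>\<close> is.\<close>

lemma form_t_pos: "\<theta> t > 0"
proof -
  have "t \<noteq> 0" using form_nonzero g_t g_zero(2) by metis
  then show ?thesis using g_pos[OF t_in] g_t[OF t_in] by simp
qed

text \<open>As \<open>\<theta> u = 0\<close>, \<open>W u\<close> is skew-symmetric, so
  \<open>g (W u t) z\<close> is \<open>- \<theta> (W u z)\<close>. Now \<open>W u z\<close> is the
  sum of a bracket and \<open>W z u\<close>, an element of \<open>U\<close>, and
  \<open>\<theta>\<close> kills both.\<close>

lemma W_U_t:
  assumes u: "u \<in> U" shows "W u t = 0"
proof (rule g_eqI)
  have uL: "u \<in> L" using u by (rule U_in_L)
  fix z assume z: "z \<in> L"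
  have "W u z = br u z + W z u"
    using W_torsion[OF uL z] by (simp add: algebra_simps)
  then have "\<theta> (W u z) = 0"
    using uL z by (simp add: form_simps closed form_br adapted W_U u)
  then show "g (W u t) z = g 0 z"
    using W_metric[OF uL t_in z] adapted[OF u] g_t[of "W u z"] uL z g_zero(2)[OF z] by simp
qed (use U_in_L[OF u] t_in in \<open>simp_all add: in_L\<close>)

text \<open>A positive multiple of the sum of the squared lengths of \<open>W e f\<close>, over
  orthonormal bases of \<open>U\<close> and of \<open>L\<close>, is written as a sum of terms that
  vanish because \<open>S\<close> is skew-symmetric both on \<open>L\<close> and on its invariant
  subspace \<open>U\<close>.\<close>

lemma W_U_zero:
  assumes u: "u \<in> U" and y: "y \<in> L"
  shows "W u y = 0"
proof -
  define S where "S y = W t y - \<theta> t *\<^sub>R y" for y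
  have S_in: "S y \<in> L" if "y \<in> L" for y
    using that t_in by (simp add: S_def in_L)
  have S_U: "S v \<in> U" if "v \<in> U" for v
    unfolding S_def using that t_in U_subspace by (intro subspace_diff subspace_scale W_U)
  have S_skew: "g (S a) b = - g (S b) a" if "a \<in> L" "b \<in> L" for a b
    using W_metric[OF t_in that] that t_in
    by (simp add: S_def g_left in_L g_commute[of a "W t b"] g_commute[of a b]
        algebra_simps)
  \<comment> \<open>This is \<open>R v t a = 0\<close> with \<open>W t\<close> split into
    \<open>S\<close> and its scalar part. The scalar terms of the commutator cancel, while the one
    from \<open>W (W t v) a\<close> stays and gives the left-hand side.\<close>
  have comm: "\<theta> t *\<^sub>R W v a = S (W v a) - W v (S a) - W (S v) a"
    if v: "v \<in> U" and a: "a \<in> L" for v a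
  proof -
    have vL: "v \<in> L" using v by (rule U_in_L)
    have "br v t = - W t v" using W_torsion[OF vL t_in] W_U_t[OF v] by simp
    then have "W v (W t a) - W t (W v a) + W (W t v) a = 0"
      using R_U_left[OF v t_in a] vL a t_in by (simp add: R_def W_left)
    then show ?thesis
      using vL a t_in by (simp add: S_def W_left W_right in_L algebra_simps)
  qed
  \<comment> \<open>Pairing \<open>comm\<close> with \<open>W v a\<close> removes the term with
    \<open>S (W v a)\<close>, by skewness.\<close>
  have normsq: "\<theta> t * g (W v a) (W v a) = - g (W v (S a)) (W v a) - g (W (S v) a) (W v a)"
    if v: "v \<in> U" and a: "a \<in> L" for v a
  proof -
    have vL: "v \<in> L" and c: "W v a \<in> L" using v a by (simp_all add: U_in_L)
    have "\<theta> t * g (W v a) (W v a) = g (\<theta> t *\<^sub>R W v a) (W v a)"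
      using c by (simp add: g_left)
    also have "\<dots> = g (S (W v a)) (W v a) - g (W v (S a)) (W v a) - g (W (S v) a) (W v a)"
      using vL a c S_in S_U U_in_L v by (simp add: comm g_left in_L)
    also have "g (S (W v a)) (W v a) = 0" using S_skew[OF c c] by simp
    finally show ?thesis by simp
  qed
  have "U \<subseteq> L" using U_in_L by blast
  then obtain E where E: "orthonormal_basis E U"
    using orthonormal_basis_exists[OF U_subspace] by blast
  obtain F where F: "orthonormal_basis F L"
    using orthonormal_basis_exists[OF subspace_L] by blast
  have EU: "E \<subseteq> U" and FL: "F \<subseteq> L" and fin: "finite E" "finite F"
    using orthonormal_basis_subset E F by (auto simp: orthonormal_basis_def)
  have EL: "E \<subseteq> L" using EU U_in_L by blast
  have in_E: "e \<in> L" if "e \<in> E" for e using that EL by blast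
  have in_F: "f \<in> L" if "f \<in> F" for f using that FL by blast
  \<comment> \<open>For fixed \<open>e\<close>, this is the trace over \<open>L\<close> of
    \<open>S\<close> against the symmetric form given by pairing images under
    \<open>W e\<close>.\<close>
  have F0: "(\<Sum>f\<in>F. g (W e (S f)) (W e f)) = 0" if "e \<in> E" for e
  proof (rule skew_symmetric_trace[OF F subspace_L, where b = "\<lambda>a b. g (W e a) (W e b)"])
    fix f assume "f \<in> F"
    then show "linear_map_on L (\<lambda>v. g (W e v) (W e f))"
      using that EL FL by (intro linear_map_onI) (auto simp: W_right g_left subset_iff)
  next
    fix f f' assume "f \<in> F" "f' \<in> F"
    then have f: "f \<in> L" "f' \<in> L" by (simp_all add: in_F)
    show "g (S f) f' = - g (S f') f" using f by (rule S_skew)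
    show "g (W e f) (W e f') = g (W e f') (W e f)"
      using f in_E[OF that] by (intro g_commute W_in)
  qed (use S_in in_F in blast)
  \<comment> \<open>Now \<open>S\<close> acts on \<open>U\<close>; the sum over \<open>F\<close>
    supplies the symmetric form on \<open>U\<close>, the trace form of the operators
    \<open>W a\<close> and \<open>W b\<close> up to sign.\<close>
  have E0: "(\<Sum>e\<in>E. \<Sum>f\<in>F. g (W (S e) f) (W e f)) = 0"
  proof (rule skew_symmetric_trace[OF E U_subspace,
        where b = "\<lambda>a b. \<Sum>f\<in>F. g (W a f) (W b f)"])
    fix e assume "e \<in> E"
    then show "linear_map_on U (\<lambda>v. \<Sum>f\<in>F. g (W v f) (W e f))"
      using EL FL U_in_L
      by (intro linear_map_onI)
        (auto simp: W_left g_left sum_distrib_left subset_iff simp flip: sum.distrib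
          intro!: sum.cong)
  next
    fix e e' assume "e \<in> E" "e' \<in> E"
    then have e: "e \<in> L" "e' \<in> L" by (simp_all add: in_E)
    show "g (S e) e' = - g (S e') e" using e by (rule S_skew)
    show "(\<Sum>f\<in>F. g (W e f) (W e' f)) = (\<Sum>f\<in>F. g (W e' f) (W e f))"
      using e by (intro sum.cong refl g_commute W_in) (simp_all add: in_F)
  qed (use S_U EU in blast)
  have "(\<Sum>e\<in>E. \<Sum>f\<in>F. \<theta> t * g (W e f) (W e f))
    = (\<Sum>e\<in>E. \<Sum>f\<in>F. - g (W e (S f)) (W e f) - g (W (S e) f) (W e f))"
    using EU FL by (intro sum.cong refl normsq) auto
  also have "\<dots> = 0"
    using F0 E0 by (simp add: sum_subtractf sum_negf)
  finally have "(\<Sum>e\<in>E. \<Sum>f\<in>F. \<theta> t * g (W e f) (W e f)) = 0" .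
  \<comment> \<open>A vanishing sum of nonnegative terms forces each term, and hence each
    \<open>W e f\<close>, to be zero; linearity in both arguments then gives the claim.\<close>
  moreover have nn: "\<theta> t * g (W e f) (W e f) \<ge> 0" if "e \<in> E" "f \<in> F" for e f
    using that form_t_pos by (intro mult_nonneg_nonneg g_nonneg W_in in_E in_F) auto
  ultimately have "\<theta> t * g (W e f) (W e f) = 0" if "e \<in> E" "f \<in> F" for e f
    using that fin by (auto simp: sum_nonneg_eq_0_iff sum_nonneg)
  then have W0: "W e f = 0" if "e \<in> E" "f \<in> F" for e f
    using that form_t_pos g_eq_0[of "W e f"] by (auto simp: in_E in_F)
  have "W e y = 0" if e: "e \<in> E" for e
  proof -
    have "W e y = W e (\<Sum>f\<in>F. g y f *\<^sub>R f)"
      using orthonormal_expansion[OF F y] by simp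
    also have "\<dots> = (\<Sum>f\<in>F. g y f *\<^sub>R W e f)"
      by (rule linear_map_on_sum[OF W_linear_right subspace_L]) (use e EL FL in auto)
    finally show ?thesis using W0[OF e] by simp
  qed
  moreover have "W u y = (\<Sum>e\<in>E. g u e *\<^sub>R W e y)"
  proof -
    have "W u y = W (\<Sum>e\<in>E. g u e *\<^sub>R e) y"
      using orthonormal_expansion[OF E u] by simp
    also have "\<dots> = (\<Sum>e\<in>E. g u e *\<^sub>R W e y)"
      by (rule linear_map_on_sum[OF W_linear_left[OF y] subspace_L]) (use EL in auto)
    finally show ?thesis .
  qed
  ultimately show ?thesis by simp
qed

text \<open>Torsion-freeness combined with \<open>W u x = 0\<close>. It follows that
  \<open>U\<close> is an abelian ideal on which \<open>L\<close> acts through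
  \<open>W\<close>.\<close>

lemma br_U: "x \<in> L \<Longrightarrow> u \<in> U \<Longrightarrow> br x u = W x u"
  using W_torsion[of x u] W_U_zero[of u x] U_in_L by simp

section \<open>The orthogonal complement of \<open>U\<close> as a Lie subalgebra\<close>

definition H :: "'a set" where "H = orthogonal_complement L g U"

lemma H_iff: "x \<in> H \<longleftrightarrow> x \<in> L \<and> (\<forall>u\<in>U. g x u = 0)"
  by (simp add: H_def orthogonal_complement_def)

lemma H_in_L: "x \<in> H \<Longrightarrow> x \<in> L"
  by (simp add: H_iff)

lemma H_subspace: "subspace H"
  using U_in_L by (auto simp: subspace_def H_iff in_L g_left g_zero)

text \<open>Since \<open>W x\<close> preserves \<open>U\<close> and is skew-symmetric up to a
  scalar, it also preserves the complement of \<open>U\<close>; the bracket is a difference of two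
  such images.\<close>

lemma H_br:
  assumes "x \<in> H" "y \<in> H" shows "br x y \<in> H"
  unfolding H_iff
proof (intro conjI ballI)
  have xy: "x \<in> L" "y \<in> L" using assms by (simp_all add: H_in_L)
  then show "br x y \<in> L" by (rule closed)
  fix u assume u: "u \<in> U"
  have uL: "u \<in> L" using u by (rule U_in_L)
  have "g (W x y) u = 0" "g (W y x) u = 0"
    using W_metric[OF xy uL] W_metric[OF xy(2,1) uL] W_U[OF xy(1) u] W_U[OF xy(2) u] assms u
    by (simp_all add: H_iff)
  then show "g (br x y) u = 0"
    using xy uL by (simp add: g_left flip: W_torsion)
qed

lemma H_lie_algebra: "lie_algebra H br"
proof
  show "\<exists>B. finite B \<and> span B = H"
    using subspace_finite_dim[OF H_subspace _ finite_dim_L] H_in_L by blast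
  fix x assume x: "x \<in> H"
  show "linear_map_on H (\<lambda>y. br y x)" "linear_map_on H (br x)"
    using linear_map_on_subset[OF linear_left] linear_map_on_subset[OF linear_right] x H_in_L
    by blast+
qed (auto intro: H_subspace H_br alternating jacobi H_in_L)

lemma closed_one_form_H: "closed_one_form H br \<theta>"
proof -
  have "{br x y |x y. x \<in> H \<and> y \<in> H} \<subseteq> {br x y |x y. x \<in> L \<and> y \<in> L}"
    using H_in_L by blast
  then have "derived_algebra H br \<subseteq> derived_algebra L br"
    unfolding derived_algebra_def by (rule span_mono)
  moreover have "linear_map_on H \<theta>"
    using linear_map_on_subset[OF form_linear] H_in_L by blast
  ultimately show ?thesis
    using closed_form by (auto simp: closed_one_form_def)
qed

text \<open>Orthogonality of \<open>t\<close> to \<open>U\<close> is precisely adaptedness. With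
  \<open>form_t_pos\<close>, \<open>t\<close> witnesses that \<open>\<theta>\<close> does not vanish
  on \<open>H\<close>.\<close>

lemma t_in_H: "t \<in> H"
  by (simp add: H_iff t_in g_t U_in_L adapted)

section \<open>The semidirect product decomposition\<close>

text \<open>The action of \<open>H\<close> on the abelian ideal \<open>U\<close> is carried over to
  \<open>real ^ 'q\<close> by an orthonormal basis of \<open>U\<close>. Orthonormality turns
  \<open>g\<close> on \<open>U\<close> into the standard inner product, so that skewness is
  preserved.\<close>

lemma semidirect_decomposition:
  assumes "CARD('q::finite) = dim U"
  shows "\<exists>\<alpha> \<beta> :: 'a \<Rightarrow> real ^ 'q \<Rightarrow> real ^ 'q.
    lie_representation H br UNIV \<alpha> \<and>
    lie_isomorphic L br (H \<times> UNIV) (semidirect_bracket br \<alpha>) \<and>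
    orthogonal_representation H br \<beta> \<and>
    (\<forall>x\<in>H. \<forall>v. \<alpha> x v = \<theta> x *\<^sub>R v + \<beta> x v)"
proof -
  have "U \<subseteq> L" using U_in_L by blast
  then obtain E where E: "orthonormal_basis E U"
    using orthonormal_basis_exists[OF U_subspace] by blast
  have EU: "E \<subseteq> U" and finE: "finite E"
    and on: "\<And>e f. e \<in> E \<Longrightarrow> f \<in> E \<Longrightarrow> g e f = (if e = f then 1 else 0)"
    using orthonormal_basis_subset[OF E] E by (auto simp: orthonormal_basis_def)
  obtain b :: "'q \<Rightarrow> 'a" where b: "bij_betw b UNIV E"
    using finite_same_card_bij[of "UNIV :: 'q set" E] finE card_orthonormal_basis[OF E] assms by auto
  have bE: "b i \<in> E" for i using b by (auto simp: bij_betw_def)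
  then have bU: "b i \<in> U" and bL: "b i \<in> L" for i using EU U_in_L by blast+
  have bb: "g (b i) (b j) = (if i = j then 1 else 0)" for i j
    using on[OF bE bE] b by (auto simp: bij_betw_def inj_eq)

  \<comment> \<open>\<open>\<iota>\<close> is the isometry onto \<open>U\<close> determined by the
    basis \<open>b\<close>, and \<open>\<pi>\<close> gives the coordinates of the orthogonal
    projection to \<open>U\<close>.\<close>
  define \<iota> :: "real ^ 'q \<Rightarrow> 'a" where "\<iota> v = (\<Sum>i\<in>UNIV. v $ i *\<^sub>R b i)" for v
  define \<pi> :: "'a \<Rightarrow> real ^ 'q" where "\<pi> z = (\<chi> i. g z (b i))" for z
  have \<iota>U: "\<iota> v \<in> U" for v
    unfolding \<iota>_def using bU U_subspace by (intro subspace_sum subspace_scale)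
  then have \<iota>L [simp]: "\<iota> v \<in> L" for v by (rule U_in_L)
  have \<iota>_linear: "linear \<iota>"
    by (rule linearI)
      (simp_all add: \<iota>_def scaleR_left_distrib sum.distrib scaleR_sum_right)
  note \<iota>_simps = linear_add[OF \<iota>_linear] linear_diff[OF \<iota>_linear] linear_scale[OF \<iota>_linear]
    linear_0[OF \<iota>_linear]
  have \<pi>_add: "\<pi> (x + y) = \<pi> x + \<pi> y" and \<pi>_diff: "\<pi> (x - y) = \<pi> x - \<pi> y"
    if "x \<in> L" "y \<in> L" for x y
    using that bL by (simp_all add: \<pi>_def vec_eq_iff g_left)
  have \<pi>_scale: "\<pi> (c *\<^sub>R x) = c *\<^sub>R \<pi> x" if "x \<in> L" for c x
    using that bL by (simp add: \<pi>_def vec_eq_iff g_left)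
  have g_\<iota>: "g z (\<iota> v) = \<pi> z \<bullet> v" if z: "z \<in> L" for z v
  proof -
    have "g z (\<iota> v) = (\<Sum>i\<in>UNIV. v $ i *\<^sub>R g z (b i))"
      unfolding \<iota>_def by (rule linear_map_on_sum[OF g_linear[OF z] subspace_L bL])
    then show ?thesis by (simp add: \<pi>_def inner_vec_def mult.commute)
  qed
  have \<pi>_\<iota> [simp]: "\<pi> (\<iota> v) = v" for v
  proof -
    have "g (\<iota> v) (b j) = v $ j" for j
    proof -
      have "g (\<iota> v) (b j) = (\<Sum>i\<in>UNIV. v $ i * g (b i) (b j))"
        unfolding \<iota>_def by (rule g_sum_left[OF bL bL])
      also have "\<dots> = (\<Sum>i\<in>UNIV. if i = j then v $ i else 0)"
        by (intro sum.cong) (auto simp: bb)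
      finally show ?thesis by simp
    qed
    then show ?thesis by (simp add: \<pi>_def vec_eq_iff)
  qed
  have \<iota>_\<pi>: "\<iota> (\<pi> u) = u" if u: "u \<in> U" for u
  proof -
    have "\<iota> (\<pi> u) = (\<Sum>i\<in>UNIV. g u (b i) *\<^sub>R b i)"
      by (simp add: \<iota>_def \<pi>_def)
    also have "\<dots> = (\<Sum>e\<in>E. g u e *\<^sub>R e)"
      by (rule sum.reindex_bij_betw[OF b])
    also have "\<dots> = u" using orthonormal_expansion[OF E u] by simp
    finally show ?thesis .
  qed
  have \<pi>_H: "\<pi> x = 0" if "x \<in> H" for x
    using that bU by (simp add: \<pi>_def vec_eq_iff H_iff)
  have proj_H: "z - \<iota> (\<pi> z) \<in> H" if z: "z \<in> L" for z
    unfolding H_iff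
  proof (intro conjI ballI)
    show "z - \<iota> (\<pi> z) \<in> L" using z by (simp add: in_L)
    fix u assume u: "u \<in> U"
    have "g (z - \<iota> (\<pi> z)) (\<iota> (\<pi> u)) = 0"
      using z by (subst g_\<iota>) (simp_all add: in_L \<pi>_diff)
    then show "g (z - \<iota> (\<pi> z)) u = 0" by (simp add: \<iota>_\<pi> u)
  qed

  \<comment> \<open>\<open>\<alpha> x\<close> is \<open>W x\<close> on \<open>U\<close> in the
    coordinates of \<open>b\<close>, and \<open>\<beta> x\<close> is its skew-symmetric part, left
    after removing the scalar \<open>\<theta> x\<close>.\<close>
  define \<alpha> where "\<alpha> x v = \<pi> (W x (\<iota> v))" for x v
  define \<beta> where "\<beta> x v = \<alpha> x v - \<theta> x *\<^sub>R v" for x v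
  have \<iota>_\<alpha>: "\<iota> (\<alpha> x v) = W x (\<iota> v)" if "x \<in> L" for x v
    unfolding \<alpha>_def using that by (intro \<iota>_\<pi> W_U \<iota>U)
  have \<alpha>_right: "\<alpha> x (v + w) = \<alpha> x v + \<alpha> x w" "\<alpha> x (v - w) = \<alpha> x v - \<alpha> x w"
    "\<alpha> x (c *\<^sub>R v) = c *\<^sub>R \<alpha> x v"
    if "x \<in> L" for x v w c
    using that by (simp_all add: \<alpha>_def \<iota>_simps W_right \<pi>_add \<pi>_diff \<pi>_scale)
  have \<alpha>_left: "y \<in> L \<Longrightarrow> \<alpha> (x + y) v = \<alpha> x v + \<alpha> y v" "\<alpha> (c *\<^sub>R x) v = c *\<^sub>R \<alpha> x v"
    if "x \<in> L" for x y v c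
    using that by (simp_all add: \<alpha>_def W_left \<pi>_add \<pi>_scale)
  have \<alpha>_br: "\<alpha> (br x y) v = \<alpha> x (\<alpha> y v) - \<alpha> y (\<alpha> x v)" if "x \<in> L" "y \<in> L" for x y v
  proof -
    have "W (br x y) (\<iota> v) = W x (W y (\<iota> v)) - W y (W x (\<iota> v))"
      using R_U[OF that \<iota>U, of v] by (simp add: R_def)
    then show ?thesis
      using that by (simp add: \<alpha>_def[of "br x y"] \<alpha>_def[of x "\<alpha> y v"] \<alpha>_def[of y "\<alpha> x v"]
          \<iota>_\<alpha> \<pi>_diff)
  qed
  interpret H: lie_algebra H br by (rule H_lie_algebra)
  have rep_\<alpha>: "lie_representation H br UNIV \<alpha>"
    by unfold_locales (auto intro!: linear_map_onI simp: \<alpha>_left \<alpha>_right \<alpha>_br H_in_L)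
  \<comment> \<open>Subtracting scalars leaves commutators unchanged, and \<open>\<theta>\<close>
    vanishes on brackets; so \<open>\<beta>\<close> inherits the bracket identity from
    \<open>\<alpha>\<close>.\<close>
  have rep_\<beta>: "lie_representation H br UNIV \<beta>"
    by unfold_locales
      (auto intro!: linear_map_onI simp: \<beta>_def \<alpha>_left \<alpha>_right \<alpha>_br H_in_L form_simps form_br
        algebra_simps)
  have "\<beta> x v \<bullet> w = - (v \<bullet> \<beta> x w)" if "x \<in> H" for x v w
  proof -
    have x: "x \<in> L" using that by (rule H_in_L)
    have "\<alpha> x v \<bullet> w = g (W x (\<iota> v)) (\<iota> w)" for v w
      using x by (simp add: \<alpha>_def g_\<iota>)
    moreover have "g (\<iota> v) (\<iota> w) = v \<bullet> w" by (simp add: g_\<iota>)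
    moreover have "g (W x (\<iota> v)) (\<iota> w) + g (W x (\<iota> w)) (\<iota> v) = 2 * \<theta> x * g (\<iota> v) (\<iota> w)"
      using W_metric[OF x, of "\<iota> v" "\<iota> w"] x by (simp add: g_commute[of "\<iota> v" "W x (\<iota> w)"])
    ultimately have "\<alpha> x v \<bullet> w + \<alpha> x w \<bullet> v = 2 * \<theta> x * (v \<bullet> w)" by simp
    then show ?thesis
      by (simp add: \<beta>_def inner_diff_left inner_diff_right inner_commute[of v "\<alpha> x w"])
  qed
  then have orth_\<beta>: "orthogonal_representation H br \<beta>"
    using rep_\<beta> by (simp add: orthogonal_representation_def)

  \<comment> \<open>The splitting of \<open>z\<close> into its part in \<open>H\<close> and the
    coordinates of its part in \<open>U\<close>; the inverse map sends \<open>(x, v)\<close> to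
    \<open>x + \<iota> v\<close>.\<close>
  define \<phi> where "\<phi> z = (z - \<iota> (\<pi> z), \<pi> z)" for z
  have \<phi>_inverse: "\<phi> (x + \<iota> v) = (x, v)" if "x \<in> H" for x v
    using that by (simp add: \<phi>_def \<pi>_add H_in_L \<pi>_H)
  have "bij_betw \<phi> L (H \<times> UNIV)"
    by (rule bij_betw_byWitness[where f' = "\<lambda>(x, v). x + \<iota> v"])
      (auto simp: \<phi>_inverse proj_H in_L H_in_L, auto simp: \<phi>_def proj_H)
  moreover have "linear_map_on L \<phi>"
    by (rule linear_map_onI) (simp_all add: \<phi>_def \<pi>_add \<pi>_scale \<iota>_simps scaleR_diff_right)
  moreover have "\<phi> (br z z') = semidirect_bracket br \<alpha> (\<phi> z) (\<phi> z')"
    if z: "z \<in> L" "z' \<in> L" for z z'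
  proof -
    define x x' v v' where "x = z - \<iota> (\<pi> z)" "x' = z' - \<iota> (\<pi> z')" "v = \<pi> z" "v' = \<pi> z'"
    note defs = this
    have H: "x \<in> H" "x' \<in> H" using z by (simp_all add: defs proj_H)
    then have L: "x \<in> L" "x' \<in> L" by (simp_all add: H_in_L)
    \<comment> \<open>Of the four brackets of components, the one within \<open>H\<close> stays
      there by \<open>H_br\<close>, the two mixed ones are given by \<open>br_U\<close>, and the one
      within \<open>U\<close> is zero.\<close>
    have "br (\<iota> v) x' = - \<iota> (\<alpha> x' v)"
      using L br_U[OF L(2) \<iota>U] br_anticommute[of "\<iota> v" x'] by (simp add: \<iota>_\<alpha>)
    moreover have "br (\<iota> v) (\<iota> v') = 0"
      by (simp add: br_U \<iota>U W_U_zero)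
    moreover have "br x (\<iota> v') = \<iota> (\<alpha> x v')"
      using L by (simp add: br_U \<iota>U \<iota>_\<alpha>)
    ultimately have "br (x + \<iota> v) (x' + \<iota> v') = br x x' + \<iota> (\<alpha> x v' - \<alpha> x' v)"
      using L by (simp add: br_left br_right in_L \<iota>_simps)
    then have "\<phi> (br (x + \<iota> v) (x' + \<iota> v')) = (br x x', \<alpha> x v' - \<alpha> x' v)"
      using \<phi>_inverse H_br H by simp
    moreover have "z = x + \<iota> v" "z' = x' + \<iota> v'" "\<phi> z = (x, v)" "\<phi> z' = (x', v')"
      by (simp_all add: defs \<phi>_def)
    ultimately show ?thesis by (simp add: semidirect_bracket_def)
  qed
  ultimately have "lie_isomorphic L br (H \<times> UNIV) (semidirect_bracket br \<alpha>)"
    unfolding lie_isomorphic_def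
    using lie_algebra_semidirect[OF rep_\<alpha>] lie_algebra_axioms by blast
  moreover have "\<alpha> x v = \<theta> x *\<^sub>R v + \<beta> x v" for x v by (simp add: \<beta>_def)
  ultimately show ?thesis using rep_\<alpha> orth_\<beta> by blast
qed

end

theorem corollary4p10:
  fixes L :: "'a::real_vector set"
    and br :: "'a \<Rightarrow> 'a \<Rightarrow> 'a"
    and g :: "'a \<Rightarrow> 'a \<Rightarrow> real"
    and \<theta> :: "'a \<Rightarrow> real"
    and U :: "'a set"
  assumes "lie_algebra L br"
    and "adapted_LCP_structure L br g \<theta> U"
    and "CARD('q::finite) = dim U"
  defines "H \<equiv> orthogonal_complement L g U"
  shows "\<exists>\<alpha> :: 'a \<Rightarrow> real ^ 'q \<Rightarrow> real ^ 'q.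
           lie_representation H br UNIV \<alpha> \<and>
           lie_isomorphic L br (H \<times> UNIV) (semidirect_bracket br \<alpha>) \<and>
           (\<exists>(\<xi> :: 'a \<Rightarrow> real) (\<beta> :: 'a \<Rightarrow> real ^ 'q \<Rightarrow> real ^ 'q).
              closed_one_form H br \<xi> \<and> (\<exists>x\<in>H. \<xi> x \<noteq> 0) \<and>
              orthogonal_representation H br \<beta> \<and>
              (\<forall>x\<in>H. \<forall>v. \<alpha> x v = \<xi> x *\<^sub>R v + \<beta> x v))"
proof -
  have LCP: "LCP_structure L br g \<theta> U" and ad: "\<And>u. u \<in> U \<Longrightarrow> \<theta> u = 0"
    using assms(2) by (auto simp: adapted_LCP_structure_def)
  interpret L: lie_algebra L br by fact
  interpret A: adapted_LCP_lie_algebra L br g \<theta> U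
    using LCP ad L.subspace L.finite_dim by unfold_locales (auto simp: LCP_structure_def)
  have "A.H = H" by (simp add: A.H_def H_def)
  \<comment> \<open>The form \<open>\<xi>\<close> is \<open>\<theta>\<close> itself, and it is
    nonzero on \<open>H\<close> because of \<open>t\<close>.\<close>
  moreover have "\<exists>x\<in>A.H. \<theta> x \<noteq> 0" using A.t_in_H A.form_t_pos by force
  ultimately show ?thesis
    using A.semidirect_decomposition[OF assms(3)] A.closed_one_form_H by metis
qed

end
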